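(* Let $\mathbb P,\mathbb X,\mathbb Y$ be real Banach spaces, let $C$ be a closed convex cone with $\{\mathbf 0\}\subsetneqq C\subsetneqq\mathbb Y$, let $\varphi:\mathbb P\times\mathbb X\to\mathbb R$, and let $F:\mathbb P\times\mathbb X\rightrightarrows\mathbb Y$ be a set-valued mapping with nonempty closed values. For $p\in\mathbb P$ put $\mathsf R(p)=\{x\in\mathbb X\mid F(p,x)\subseteq C\}$ and $\mathsf{val}(p)=\inf_{x\in\mathsf R(p)}\varphi(p,x)$. Suppose that: (i) $\varphi:\mathbb P\times\mathbb X\to\mathbb R$ is convex; (ii) $F:\mathbb P\times\mathbb X\rightrightarrows\mathbb Y$ is $C$-concave. Then $\mathsf{val}:\mathbb P\to\mathbb R\cup\{\pm\infty\}$ is convex.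
   Context: A set-valued mapping $G:\mathbb V\rightrightarrows\mathbb Y$ between real vector spaces is $C$-concave if $G(tv_1+(1-t)v_2)\subseteq tG(v_1)+(1-t)G(v_2)+C$ for all $v_1,v_2\in\mathbb V$ and $t\in[0,1]$. The infimum over the empty set is $+\infty$. Convexity of an extended-real-valued function means that its epigraph $\{(p,r)\in\mathbb P\times\mathbb R\mid \mathsf{val}(p)\le r\}$ is convex. *)

theory Defs
  imports "HOL-Analysis.Analysis"
begin

text \<open>
  A set-valued mapping from \<open>'v\<close> to \<open>'y\<close> is a function \<open>'v \<Rightarrow> 'y set\<close>.  The sums below are
  Minkowski sums (\<open>HOL-Library.Set_Algebras\<close>); a scalar multiple of a set is written as an image.
\<close>

definition cone_concave :: "'y::real_vector set \<Rightarrow> ('v::real_vector \<Rightarrow> 'y set) \<Rightarrow> bool" where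
  "cone_concave C G \<longleftrightarrow>
     (\<forall>v1 v2. \<forall>t\<in>{0..1::real}.
        G (t *\<^sub>R v1 + (1 - t) *\<^sub>R v2) \<subseteq> (\<lambda>y. t *\<^sub>R y) ` G v1 + (\<lambda>y. (1 - t) *\<^sub>R y) ` G v2 + C)"

definition feasible_set :: "'y set \<Rightarrow> ('p \<times> 'x \<Rightarrow> 'y set) \<Rightarrow> 'p \<Rightarrow> 'x set" where
  "feasible_set C F p = {x. F (p, x) \<subseteq> C}"

text \<open>The infimum is taken in \<open>ereal\<close>, so it is \<open>\<infinity>\<close> when the feasible set is empty.\<close>

definition value_function ::
    "('p \<times> 'x \<Rightarrow> real) \<Rightarrow> 'y set \<Rightarrow> ('p \<times> 'x \<Rightarrow> 'y set) \<Rightarrow> 'p \<Rightarrow> ereal" where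
  "value_function \<phi> C F p = (INF x\<in>feasible_set C F p. ereal (\<phi> (p, x)))"

text \<open>
  The library's \<open>epigraph\<close> and \<open>convex_on\<close> only cover real-valued functions.  Here the second
  component of the epigraph is still real, also where the function is \<open>\<infinity>\<close> or \<open>-\<infinity>\<close>.
\<close>

definition ereal_epigraph :: "('p \<Rightarrow> ereal) \<Rightarrow> ('p \<times> real) set" where
  "ereal_epigraph f = {(p, r). f p \<le> ereal r}"

definition ereal_convex :: "('p::real_vector \<Rightarrow> ereal) \<Rightarrow> bool" where
  "ereal_convex f \<longleftrightarrow> convex (ereal_epigraph f)"

end

theory Submission
  imports Defs
begin

text \<open>
  The value function is the partial infimum over \<open>x\<close> of the jointly convex \<open>\<phi>\<close> on the graph
  \<open>{(p, x). F (p, x) \<subseteq> C}\<close>, and partial infima of convex functions over convex sets are convex.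
  So everything rests on the convexity of that graph.  Concavity encloses the value of \<open>F\<close> at a
  convex combination of two feasible points in a convex combination of two subsets of \<open>C\<close>, plus
  \<open>C\<close>, and a convex cone absorbs such sums.

  The infimum need not be attained, and it may be \<open>-\<infinity>\<close>, so the epigraph inequality is proved up
  to an arbitrary \<open>\<epsilon> > 0\<close>: a finite upper bound \<open>r\<close> on the value guarantees that there is
  a feasible point with objective below \<open>r + \<epsilon>\<close>, and two such points can be combined.
\<close>

text \<open>
  With \<open>v = (p, x)\<close> this is the graph of the feasible-set mapping.  It needs concavity rather than
  convexity of \<open>G\<close>, because the inclusion must bound \<open>G\<close> at the intermediate point from above by
  its values at the two given points.
\<close>

lemma cone_concave_convex_graph:
  fixes C :: "'y::real_vector set" and G :: "'v::real_vector \<Rightarrow> 'y set"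
  assumes C: "convex_cone C" and G: "cone_concave C G"
  shows "convex {v. G v \<subseteq> C}"
proof (rule convexI, clarify)
  fix v w :: 'v and t s :: real and y
  assume v: "G v \<subseteq> C" and w: "G w \<subseteq> C"
    and ts: "0 \<le> t" "0 \<le> s" "t + s = 1" and y: "y \<in> G (t *\<^sub>R v + s *\<^sub>R w)"
  have s: "s = 1 - t" and t: "t \<in> {0..1}"
    using ts by auto
  have "y \<in> (\<lambda>y. t *\<^sub>R y) ` G v + (\<lambda>y. s *\<^sub>R y) ` G w + C"
    using G[unfolded cone_concave_def, rule_format, OF t, of v w] y unfolding s by (rule subsetD)
  then obtain a b c where abc: "a \<in> G v" "b \<in> G w" "c \<in> C" "y = t *\<^sub>R a + s *\<^sub>R b + c"
    by (auto elim!: set_plus_elim)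
  have "t *\<^sub>R a \<in> C" "s *\<^sub>R b \<in> C"
    using C v w abc ts by (auto intro!: convex_cone_scaleR)
  then show "y \<in> C"
    using C abc by (auto intro!: convex_cone_add)
qed

text \<open>
  The bound is strict because the infimum need not be attained: a value equal to \<open>r\<close> may come with
  no feasible point whose objective is at most \<open>r\<close>.
\<close>

lemma value_function_less_obtains:
  assumes "value_function \<phi> C F p < ereal r"
  obtains x where "F (p, x) \<subseteq> C" and "\<phi> (p, x) < r"
  using assms by (auto simp: value_function_def feasible_set_def INF_less_iff)

lemma value_function_le:
  assumes "F (p, x) \<subseteq> C"
  shows "value_function \<phi> C F p \<le> ereal (\<phi> (p, x))"
  using assms by (auto simp: value_function_def feasible_set_def intro: INF_lower)

theorem proposition3p1:
  fixes C :: "'y::banach set"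
    and \<phi> :: "'p::banach \<times> 'x::banach \<Rightarrow> real"
    and F :: "'p \<times> 'x \<Rightarrow> 'y set"
  assumes "closed C" and "convex_cone C" and "{0} \<subset> C" and "C \<subset> UNIV"
    and "\<And>p x. F (p, x) \<noteq> {}" and "\<And>p x. closed (F (p, x))"
    and "convex_on UNIV \<phi>"
    and "cone_concave C F"
  shows "ereal_convex (value_function \<phi> C F)"
  unfolding ereal_convex_def
proof (rule convexI, clarify)
  let ?V = "value_function \<phi> C F"
  fix p q :: 'p and r s t u :: real
  assume "(p, r) \<in> ereal_epigraph ?V" and "(q, s) \<in> ereal_epigraph ?V"
    and tu: "0 \<le> t" "0 \<le> u" "t + u = 1"
  then have r: "?V p \<le> ereal r" and s: "?V q \<le> ereal s"
    by (auto simp: ereal_epigraph_def)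
  have "?V (t *\<^sub>R p + u *\<^sub>R q) \<le> ereal (t * r + u * s) + ereal e" if e: "0 < e" for e
  proof -
    have "?V p < ereal (r + e)" and "?V q < ereal (s + e)"
      using e le_less_trans[OF r, of "ereal (r + e)"] le_less_trans[OF s, of "ereal (s + e)"]
      by simp_all
    obtain x where x: "F (p, x) \<subseteq> C" "\<phi> (p, x) < r + e"
      using \<open>?V p < ereal (r + e)\<close> by (rule value_function_less_obtains)
    obtain y where y: "F (q, y) \<subseteq> C" "\<phi> (q, y) < s + e"
      using \<open>?V q < ereal (s + e)\<close> by (rule value_function_less_obtains)
    let ?z = "t *\<^sub>R (p, x) + u *\<^sub>R (q, y)"
    have "?z \<in> {v. F v \<subseteq> C}"
      by (rule convexD[OF cone_concave_convex_graph[OF assms(2,8)]]) (use x y tu in simp_all)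
    then have "?V (t *\<^sub>R p + u *\<^sub>R q) \<le> ereal (\<phi> ?z)"
      using value_function_le[of F "t *\<^sub>R p + u *\<^sub>R q" "t *\<^sub>R x + u *\<^sub>R y" C \<phi>] by simp
    also have "\<phi> ?z \<le> t * r + u * s + e"
    proof -
      have "\<phi> ?z \<le> t * \<phi> (p, x) + u * \<phi> (q, y)"
        using assms(7) tu unfolding convex_on_def by simp
      also have "\<dots> \<le> t * (r + e) + u * (s + e)"
        using x y tu by (intro add_mono mult_left_mono) auto
      also have "\<dots> = t * r + u * s + (t + u) * e"
        by (simp add: algebra_simps)
      finally show ?thesis
        using tu by simp
    qed
    finally show ?thesis
      by simp
  qed
  then have "?V (t *\<^sub>R p + u *\<^sub>R q) \<le> ereal (t * r + u * s)"
    by (blast intro: ereal_le_epsilon2)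
  then show "t *\<^sub>R (p, r) + u *\<^sub>R (q, s) \<in> ereal_epigraph ?V"
    by (simp add: ereal_epigraph_def)
qed

end
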